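(* Let $F:\{0,\dots,k-1\}^n\to\mathbb{R}$ be any normalized function and let $f_{\downarrow}$ be its continuous extension. Then $$\min_{x\in\{0,\dots,k-1\}^n}F(x)=\min_{X\in[0,1]_{\downarrow}^{n\times(k-1)}}f_{\downarrow}(X).$$ Moreover, if $x^*$ is a minimizer of $F$ over $\{0,\dots,k-1\}^n$, then $\Theta^{-1}(x^* )$ is a minimizer of $f_{\downarrow}$ over $[0,1]_{\downarrow}^{n\times(k-1)}$; and if $X^*$ is a minimizer of $f_{\downarrow}$ over $[0,1]_{\downarrow}^{n\times(k-1)}$, then $\mathrm{Round}_F(X^* )$ is a minimizer of $F$ over $\{0,\dots,k-1\}^n$.
   Context: Let $n\ge1$, $k\ge 2$ be integers. $F$ is normalized if $F(\mathbf{0})=0$. For $S\in\{\{0,1\},[0,1],\mathbb{R}\}$, $S_{\downarrow}^{n\times(k-1)}$ denotes the set of matrices $X\in S^{n\times(k-1)}$ whose rows are non-increasing: $X_{i,j}\ge X_{i,j+1}$ for all $i,j$. A non-increasing permutation of $X\in\mathbb{R}^{n\times(k-1)}$ is an enumeration $(p,q)=((p_1,q_1),\dots,(p_{n(k-1)},q_{n(k-1)}))$ of all index pairs with $X_{p_i,q_i}\ge X_{p_{i+1},q_{i+1}}$ for all $i$. Continuous extension: for $X\in\mathbb{R}_{\downarrow}^{n\times(k-1)}$ and a non-increasing permutation $(p,q)$ of $X$, set $y^0=\mathbf{0}$ and $y^i=y^{i-1}+e_{p_i}$ for $i=1,\dots,(k-1)n$ (where $e_j$ is the $j$-th standard basis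 vector of $\mathbb{R}^n$), and $f_{\downarrow}(X)=\sum_{i=1}^{(k-1)n}X_{p_i,q_i}\big(F(y^i)-F(y^{i-1})\big)$; this value does not depend on the choice of $(p,q)$. For $X\notin\mathbb{R}_{\downarrow}^{n\times(k-1)}$, $f_{\downarrow}(X)=+\infty$. $\Theta:\{0,1\}_{\downarrow}^{n\times(k-1)}\to\{0,\dots,k-1\}^n$ is the bijection $\Theta(X)=X\mathbf{1}$ (row sums), with inverse $\Theta^{-1}(x)=X$, $X_{i,j}=1$ if $j\le x_i$ and $X_{i,j}=0$ if $j>x_i$. Rounding: for $X\in[0,1]_{\downarrow}^{n\times(k-1)}$, $\mathrm{Round}_F(X)=y^{i^*}$, where, for a non-increasing permutation $(p,q)$ of $X$, $y^0=\mathbf{0}$ and $y^i=y^{i-1}+e_{p_i}$ for $i=1,\dots,(k-1)n$, and $i^*\in\arg\min_{0\le i\le(k-1)n}F(y^i)$ (any choice of permutation and of minimizing index). *)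

theory Defs
  imports Complex_Main "HOL-Library.Extended_Real" "Jordan_Normal_Form.Matrix"
begin

text \<open>Matrix and vector indices start at \<open>0\<close>, so rows are \<open>0,\<dots>,n-1\<close> and columns \<open>0,\<dots>,k-2\<close>.\<close>

definition grid :: "nat \<Rightarrow> nat \<Rightarrow> real vec set" where
  "grid n k = {x \<in> carrier_vec n. \<forall>i<n. x $ i \<in> real ` {0..k-1}}"

text \<open>Only the values of \<open>F\<close> on \<open>grid n k\<close> matter below.\<close>

definition normalized :: "nat \<Rightarrow> (real vec \<Rightarrow> real) \<Rightarrow> bool" where
  "normalized n F \<longleftrightarrow> F (0\<^sub>v n) = 0"

definition down_mats :: "nat \<Rightarrow> nat \<Rightarrow> real set \<Rightarrow> real mat set" where
  "down_mats n k S = {X \<in> carrier_mat n (k-1).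
     (\<forall>i<n. \<forall>j<k-1. X $$ (i,j) \<in> S) \<and>
     (\<forall>i<n. \<forall>j. j + 1 < k-1 \<longrightarrow> X $$ (i,j) \<ge> X $$ (i,j+1))}"

definition noninc_perm :: "nat \<Rightarrow> nat \<Rightarrow> real mat \<Rightarrow> (nat \<times> nat) list \<Rightarrow> bool" where
  "noninc_perm n k X pq \<longleftrightarrow> distinct pq \<and> set pq = {..<n} \<times> {..<k-1} \<and>
     (\<forall>i. i + 1 < length pq \<longrightarrow> X $$ (pq ! i) \<ge> X $$ (pq ! (i+1)))"

primrec chain :: "nat \<Rightarrow> (nat \<times> nat) list \<Rightarrow> nat \<Rightarrow> real vec" where
  "chain n pq 0 = 0\<^sub>v n"
| "chain n pq (Suc i) = chain n pq i + unit_vec n (fst (pq ! i))"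

definition chain_sum :: "nat \<Rightarrow> nat \<Rightarrow> (real vec \<Rightarrow> real) \<Rightarrow> real mat \<Rightarrow> (nat \<times> nat) list \<Rightarrow> real" where
  "chain_sum n k F X pq =
     (\<Sum>i<(k-1)*n. X $$ (pq ! i) * (F (chain n pq (Suc i)) - F (chain n pq i)))"

text \<open>The choice of the non-increasing permutation is immaterial, see \<open>f_down_eq\<close> below.\<close>

definition f_down :: "nat \<Rightarrow> nat \<Rightarrow> (real vec \<Rightarrow> real) \<Rightarrow> real mat \<Rightarrow> ereal" where
  "f_down n k F X = (if X \<in> down_mats n k UNIV
     then ereal (chain_sum n k F X (SOME pq. noninc_perm n k X pq)) else \<infinity>)"

definition Theta :: "real mat \<Rightarrow> real vec" where
  "Theta X = X *\<^sub>v vec (dim_col X) (\<lambda>_. 1)"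

text \<open>Because columns are numbered from \<open>0\<close>, the usual condition \<open>j \<le> x\<^sub>i\<close> reads \<open>j + 1 \<le> x $ i\<close>.\<close>

definition Theta_inv :: "nat \<Rightarrow> nat \<Rightarrow> real vec \<Rightarrow> real mat" where
  "Theta_inv n k x = mat n (k-1) (\<lambda>(i,j). if real (j+1) \<le> x $ i then 1 else 0)"

text \<open>All possible outcomes of rounding \<open>X\<close>, over every admissible choice of permutation and of
  minimizing index.\<close>

definition Rounds :: "nat \<Rightarrow> nat \<Rightarrow> (real vec \<Rightarrow> real) \<Rightarrow> real mat \<Rightarrow> real vec set" where
  "Rounds n k F X = {chain n pq i | pq i. noninc_perm n k X pq \<and>
     is_arg_min (\<lambda>i. F (chain n pq i)) (\<lambda>i. i \<le> (k-1)*n) i}"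


lemma noninc_perm_length:
  assumes "noninc_perm n k X pq"
  shows "length pq = (k-1)*n"
proof -
  have "length pq = card (set pq)" using assms distinct_card[of pq] unfolding noninc_perm_def by simp
  also have "\<dots> = card ({..<n} \<times> {..<k-1})" using assms by (simp only: noninc_perm_def)
  also have "\<dots> = (k-1)*n" by (simp add: card_cartesian_product)
  finally show ?thesis .
qed

lemma noninc_perm_exists: "\<exists>pq. noninc_perm n k X pq"
proof -
  obtain xs where xs: "set xs = {..<n} \<times> {..<k-1}" "distinct xs"
    using finite_distinct_list[of "{..<n} \<times> {..<k-1}"] by auto
  let ?p = "sort_key (\<lambda>z. - X $$ z) xs"
  have s: "sorted (map (\<lambda>z. - X $$ z) ?p)" by simp
  have "X $$ (?p ! i) \<ge> X $$ (?p ! (i+1))" if "i + 1 < length ?p" for i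
    using sorted_nth_mono[OF s, of i "i+1"] that by simp
  then have "noninc_perm n k X ?p" using xs by (simp add: noninc_perm_def)
  then show ?thesis by blast
qed

lemma Rounds_nonempty: "Rounds n k F X \<noteq> {}"
proof -
  obtain pq where pq: "noninc_perm n k X pq" using noninc_perm_exists by blast
  have "\<exists>i. is_arg_min (\<lambda>i. F (chain n pq i)) (\<lambda>i. i \<in> {..(k-1)*n}) i"
    by (rule ex_is_arg_min_if_finite) auto
  then show ?thesis using pq by (auto simp: Rounds_def)
qed

lemma chain_eq_card:
  assumes "distinct pq" "set pq \<subseteq> {..<n} \<times> B" "i \<le> length pq"
  shows "chain n pq i = vec n (\<lambda>r. real (card {z \<in> set (take i pq). fst z = r}))"
  using assms(3)
proof (induction i)
  case 0
  show ?case by (auto simp: zero_vec_def)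
next
  case (Suc i)
  then have l: "i < length pq" by simp
  have new: "pq ! i \<notin> set (take i pq)"
    using assms(1) l by (metis distinct_take id_take_nth_drop not_distinct_conv_prefix take_Suc_conv_app_nth)
  have "{z \<in> set (take (Suc i) pq). fst z = r} =
     (if fst (pq ! i) = r then insert (pq ! i) {z \<in> set (take i pq). fst z = r}
      else {z \<in> set (take i pq). fst z = r})" for r
    using l by (auto simp: take_Suc_conv_app_nth)
  moreover have "fst (pq ! i) < n" using assms(2) l nth_mem by fastforce
  moreover have "card (insert (pq ! i) {z \<in> set (take i pq). fst z = r}) =
     Suc (card {z \<in> set (take i pq). fst z = r})" for r
    using new by (intro card_insert_disjoint) auto
  moreover have "chain n pq i = vec n (\<lambda>r. real (card {z \<in> set (take i pq). fst z = r}))"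
    using Suc.IH l by simp
  ultimately show ?case
    by (intro eq_vecI) (simp_all only: chain.simps index_add_vec index_vec dim_vec index_unit_vec, auto)
qed

lemma noninc_perm_nth_mono:
  assumes "noninc_perm n k X pq" "i \<le> j" "j < length pq"
  shows "X $$ (pq ! j) \<le> X $$ (pq ! i)"
  using assms(2,3)
proof (induction j rule: dec_induct)
  case (step m)
  have "X $$ (pq ! (m+1)) \<le> X $$ (pq ! m)"
    using assms(1) step.prems by (auto simp: noninc_perm_def)
  with step show ?case by simp
qed simp

lemma noninc_perm_values_unique:
  assumes "noninc_perm n k X p" "noninc_perm n k X q"
  shows "map (\<lambda>z. X $$ z) p = map (\<lambda>z. X $$ z) q"
proof -
  let ?g = "\<lambda>z. - X $$ z"
  have s: "sorted (map ?g r)" if "noninc_perm n k X r" for r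
    using noninc_perm_nth_mono[OF that] by (auto simp: sorted_iff_nth_mono)
  have "mset p = mset q" using assms by (auto simp: noninc_perm_def set_eq_iff_mset_eq_distinct[symmetric])
  then have "mset (map ?g p) = mset (map ?g q)" by simp
  then have "map ?g p = map ?g q"
    using s[OF assms(1)] s[OF assms(2)] by (metis properties_for_sort)
  then have "map uminus (map ?g p) = map uminus (map ?g q)" by simp
  then show ?thesis by (simp add: comp_def)
qed

lemma noninc_perm_take:
  assumes p: "noninc_perm n k X p" and i: "0 < i" "i < length p"
    and lt: "X $$ (p ! i) < X $$ (p ! (i-1))"
  shows "set (take i p) = {z \<in> {..<n} \<times> {..<k-1}. X $$ (p ! i) < X $$ z}"
proof -
  have S: "set p = {..<n} \<times> {..<k-1}" using p by (simp add: noninc_perm_def)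
  show ?thesis
  proof (intro equalityI subsetI)
    fix z assume "z \<in> set (take i p)"
    then obtain j where j: "j < i" "z = p ! j" using i by (auto simp: in_set_conv_nth)
    then have "X $$ (p ! (i-1)) \<le> X $$ z"
      using noninc_perm_nth_mono[OF p, of j "i-1"] i by simp
    moreover have "z \<in> set p" using j i by auto
    ultimately show "z \<in> {z \<in> {..<n} \<times> {..<k-1}. X $$ (p ! i) < X $$ z}" using lt S by auto
  next
    fix z assume z: "z \<in> {z \<in> {..<n} \<times> {..<k-1}. X $$ (p ! i) < X $$ z}"
    then have "z \<in> set p" using S by simp
    then obtain j where j: "j < length p" "z = p ! j" by (auto simp: in_set_conv_nth)
    have "j < i"
    proof (rule ccontr)
      assume "\<not> j < i"
      then have "X $$ z \<le> X $$ (p ! i)" using noninc_perm_nth_mono[OF p, of i j] j by simp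
      with z show False by simp
    qed
    then show "z \<in> set (take i p)" using j by (auto simp: in_set_conv_nth)
  qed
qed

lemma chain_sum_unique:
  assumes p: "noninc_perm n k X p" and q: "noninc_perm n k X q"
  shows "chain_sum n k F X p = chain_sum n k F X q"
proof -
  define N where "N = (k-1)*n"
  have lp: "length p = N" and lq: "length q = N" using noninc_perm_length p q N_def by auto
  have v: "X $$ (p ! i) = X $$ (q ! i)" if "i < N" for i
    using noninc_perm_values_unique[OF p q] that lp lq by (metis nth_map)
  define D where "D i = F (chain n p i) - F (chain n q i)" for i
  have c: "chain n r i = vec n (\<lambda>s. real (card {z \<in> set (take i r). fst z = s}))"
    if r: "noninc_perm n k X r" and i: "i \<le> N" for r i
  proof (rule chain_eq_card)
    show "distinct r" "set r \<subseteq> {..<n} \<times> {..<k-1}" using r by (auto simp: noninc_perm_def)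
    show "i \<le> length r" using i noninc_perm_length[OF r] by (simp add: N_def)
  qed
  have DN: "D N = 0"
    using c[OF p, of N] c[OF q, of N] lp lq p q by (simp add: D_def noninc_perm_def)
  have D: "D i = 0" if "0 < i" "i < N" "X $$ (p ! i) \<noteq> X $$ (p ! (i-1))" for i
  proof -
    have lt: "X $$ (p ! i) < X $$ (p ! (i-1))"
      using noninc_perm_nth_mono[OF p, of "i-1" i] that lp by simp
    have "set (take i p) = set (take i q)"
      using noninc_perm_take[OF p, of i] noninc_perm_take[OF q, of i] lt that lp lq v[of i] v[of "i-1"]
      by simp
    then show ?thesis using c[OF p, of i] c[OF q, of i] that by (simp add: D_def)
  qed
  have A: "(\<Sum>i<M. X $$ (p ! i) * (D (Suc i) - D i)) = (if M = 0 then 0 else X $$ (p ! (M-1)) * D M)"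
    if "M \<le> N" for M
    using that
  proof (induction M)
    case (Suc M)
    show ?case
    proof (cases "M = 0")
      case True
      then show ?thesis by (simp add: D_def)
    next
      case False
      then have "X $$ (p ! (M-1)) * D M = X $$ (p ! M) * D M" using D[of M] Suc.prems by auto
      then show ?thesis using Suc False by (simp add: algebra_simps)
    qed
  qed simp
  have "chain_sum n k F X p - chain_sum n k F X q = (\<Sum>i<N. X $$ (p ! i) * (D (Suc i) - D i))"
    unfolding chain_sum_def N_def[symmetric] sum_subtractf[symmetric]
    by (rule sum.cong) (auto simp: v D_def algebra_simps)
  also have "\<dots> = 0" using A[of N] DN by simp
  finally show ?thesis by simp
qed

lemma f_down_eq:
  assumes "X \<in> down_mats n k UNIV" "noninc_perm n k X pq"
  shows "f_down n k F X = ereal (chain_sum n k F X pq)"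
  using assms chain_sum_unique[OF someI[of "noninc_perm n k X", OF assms(2)] assms(2)]
  by (simp add: f_down_def)

lemma Theta_inv_mem:
  "Theta_inv n k x \<in> down_mats n k {0,1}"
  by (auto simp: Theta_inv_def down_mats_def)

lemma Theta_Theta_inv:
  assumes "x \<in> grid n k"
  shows "Theta (Theta_inv n k x) = x"
proof (rule eq_vecI)
  fix i assume "i < dim_vec x"
  moreover have "x \<in> carrier_vec n" using assms by (simp add: grid_def)
  ultimately have i: "i < n" by simp
  then have "x $ i \<in> real ` {0..k-1}" using assms unfolding grid_def by blast
  then obtain m where m: "x $ i = real m" "m \<le> k-1" by auto
  have "Theta (Theta_inv n k x) $ i = (\<Sum>j=0..<k-1. if j + 1 \<le> m then 1 else 0)"
    using i m by (simp add: Theta_def Theta_inv_def scalar_prod_def del: of_nat_Suc)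
  also have "\<dots> = real (card {j \<in> {0..<k-1}. j + 1 \<le> m})"
    by (simp add: sum.If_cases Int_def)
  also have "{j \<in> {0..<k-1}. j + 1 \<le> m} = {0..<m}" using m by auto
  finally show "Theta (Theta_inv n k x) $ i = x $ i" using m by simp
next
  have "x \<in> carrier_vec n" using assms by (simp add: grid_def)
  then show "dim_vec (Theta (Theta_inv n k x)) = dim_vec x" by (simp add: Theta_def Theta_inv_def)
qed

lemma Theta_inv_Theta:
  assumes X: "X \<in> down_mats n k {0,1}"
  shows "Theta X \<in> grid n k" "Theta_inv n k (Theta X) = X"
proof -
  have dX: "dim_row X = n" "dim_col X = k-1" using X by (auto simp: down_mats_def)
  have *: "\<exists>m\<le>k-1. Theta X $ i = real m \<and> (\<forall>j<k-1. X $$ (i,j) = (if j < m then 1 else 0))"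
    if i: "i < n" for i
  proof -
    have b: "X $$ (i,j) \<in> {0,1}" if "j < k-1" for j using X i that by (auto simp: down_mats_def)
    have mono: "X $$ (i,j') \<le> X $$ (i,j)" if "j \<le> j'" "j' < k-1" for j j'
      using that
    proof (induction j' rule: dec_induct)
      case (step m)
      then have "X $$ (i,m+1) \<le> X $$ (i,m)" using X i by (auto simp: down_mats_def)
      with step show ?case by simp
    qed simp
    define m where "m = (LEAST j. j = k-1 \<or> (j < k-1 \<and> X $$ (i,j) = 0))"
    have m: "m = k-1 \<or> (m < k-1 \<and> X $$ (i,m) = 0)"
      unfolding m_def by (rule LeastI[of _ "k-1"]) simp
    have e: "X $$ (i,j) = (if j < m then 1 else 0)" if j: "j < k-1" for j
    proof (cases "j < m")
      case True
      then have "\<not> (j = k-1 \<or> (j < k-1 \<and> X $$ (i,j) = 0))" unfolding m_def by (rule not_less_Least)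
      then show ?thesis using b[OF j] j True by auto
    next
      case False
      then show ?thesis using mono[of m j] m b[OF j] j by auto
    qed
    have "Theta X $ i = (\<Sum>j=0..<k-1. X $$ (i,j))"
      using i dX by (simp add: Theta_def scalar_prod_def)
    also have "\<dots> = (\<Sum>j=0..<k-1. if j < m then 1 else 0)" by (rule sum.cong) (auto simp: e)
    also have "\<dots> = real (card {j \<in> {0..<k-1}. j < m})" by (simp add: sum.If_cases Int_def)
    also have "{j \<in> {0..<k-1}. j < m} = {0..<m}" using m by auto
    finally have "Theta X $ i = real m" by simp
    moreover have "m \<le> k-1" using m by auto
    ultimately show ?thesis using e by blast
  qed
  show "Theta X \<in> grid n k" using * dX by (force simp: grid_def Theta_def intro!: carrier_vecI)
  show "Theta_inv n k (Theta X) = X"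
  proof (rule eq_matI)
    fix i j assume "i < dim_row X" "j < dim_col X"
    then show "Theta_inv n k (Theta X) $$ (i,j) = X $$ (i,j)"
      using *[of i] dX by (auto simp: Theta_inv_def)
  qed (simp_all add: Theta_inv_def dX)
qed

lemma Theta_bij: "bij_betw Theta (down_mats n k {0,1}) (grid n k)"
  by (rule bij_betw_byWitness[where f' = "Theta_inv n k"])
    (simp_all add: Theta_Theta_inv Theta_inv_Theta Theta_inv_mem image_subset_iff)

lemma grid_nonempty: "grid n k \<noteq> {}"
proof -
  have "0\<^sub>v n \<in> grid n k" by (auto simp: grid_def)
  then show ?thesis by blast
qed

lemma finite_grid: "finite (grid n k)"
proof -
  have "x \<in> vec_of_list ` {l. set l \<subseteq> real ` {0..k-1} \<and> length l = n}" if "x \<in> grid n k" for x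
  proof (rule image_eqI)
    show "x = vec_of_list (list_of_vec x)" by (simp add: vec_list)
    show "list_of_vec x \<in> {l. set l \<subseteq> real ` {0..k-1} \<and> length l = n}"
      using that by (auto simp: grid_def set_list_of_vec vec_set_def)
  qed
  then have "grid n k \<subseteq> vec_of_list ` {l. set l \<subseteq> real ` {0..k-1} \<and> length l = n}"
    by (rule subsetI)
  moreover have "finite {l. set l \<subseteq> real ` {0..k-1} \<and> length l = n}"
    by (rule finite_lists_length_eq) simp
  ultimately show ?thesis by (metis finite_subset finite_imageI)
qed

end

theory Submission
  imports Defs
begin

text \<open>Read along a non-increasing permutation of \<open>X\<close>, the value \<open>f\<^sub>\<down>(X)\<close> is a Stieltjes-type sum of the
  entries of \<open>X\<close> against the increments of \<open>F\<close> along a chain from \<open>0\<close> in the grid. Two facts about this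
  sum carry the theorem.

  For entries in \<open>[0,1]\<close>, summation by parts turns it into a combination of the values of \<open>F\<close>
  on the chain with nonnegative coefficients: the drops between consecutive entries, together with
  the last entry and one minus the first. These coefficients add up to \<open>1\<close>, where the weight on
  the origin is harmless because \<open>F(0) = 0\<close>. So \<open>f\<^sub>\<down>(X)\<close> is an average of values of \<open>F\<close> and cannot
  be smaller than the least of them, which is the value of \<open>F\<close> at a rounding of \<open>X\<close> along the same
  permutation (\<open>Rounds_le_f_down\<close>).

  For a binary \<open>X\<close> the sum telescopes, since the ones come first; what is left is the value of
  \<open>F\<close> at the point that the chain has reached after the last one, and this point is \<open>\<Theta>(X)\<close>
  (\<open>f_down_binary\<close>). So \<open>f\<^sub>\<down>\<close> extends \<open>F\<close>.

  Consequently \<open>F(r) \<le> f\<^sub>\<down>(X)\<close> for every rounding \<open>r\<close> of \<open>X\<close>, and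
  \<open>f\<^sub>\<down>(\<Theta>\<^sup>-\<^sup>1(x)) = F(x)\<close>: each side can be matched by the other without
  increasing the objective, and all claims follow.\<close>

text \<open>This is the averaging argument, in a form that avoids rewriting the sum: the stronger
  claim with a lower bound \<open>c\<close> on the weights goes through by induction, because the last weight can
  itself serve as \<open>c\<close> for the preceding terms.\<close>

lemma weighted_increments_lower_bound:
  fixes w g :: "nat \<Rightarrow> real"
  assumes decr: "\<And>i j. i \<le> j \<Longrightarrow> j < N \<Longrightarrow> w j \<le> w i"
    and w: "\<And>i. i < N \<Longrightarrow> 0 \<le> w i \<and> w i \<le> 1"
    and g: "\<And>i. i \<le> N \<Longrightarrow> m \<le> g i"
  shows "m - g 0 \<le> (\<Sum>i<N. w i * (g (Suc i) - g i))"
proof -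
  have "c * (g M - m) - (g 0 - m) \<le> (\<Sum>i<M. w i * (g (Suc i) - g i))"
    if "M \<le> N" "0 \<le> c" "c \<le> 1" "\<forall>i<M. c \<le> w i" for M c
    using that
  proof (induction M arbitrary: c)
    case 0
    then show ?case using g[of 0] mult_right_mono[of c 1 "g 0 - m"] by simp
  next
    case (Suc M)
    have "w M * (g M - m) - (g 0 - m) \<le> (\<Sum>i<M. w i * (g (Suc i) - g i))"
      using Suc.prems w[of M] decr by (intro Suc.IH) auto
    moreover have "c * (g (Suc M) - m) \<le> w M * (g (Suc M) - m)"
      using Suc.prems g[of "Suc M"] by (intro mult_right_mono) auto
    ultimately show ?case by (simp add: algebra_simps)
  qed
  from this[of N 0] w show ?thesis by simp
qed

lemma chain_in_grid:
  assumes pq: "noninc_perm n k X pq" and i: "i \<le> (k-1)*n"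
  shows "chain n pq i \<in> grid n k"
proof -
  have c: "chain n pq i = vec n (\<lambda>r. real (card {z \<in> set (take i pq). fst z = r}))"
    using pq i noninc_perm_length[OF pq]
    by (intro chain_eq_card[where B = "{..<k-1}"]) (auto simp: noninc_perm_def)
  have "card {z \<in> set (take i pq). fst z = r} \<le> k-1" for r
  proof -
    have "{z \<in> set (take i pq). fst z = r} \<subseteq> {r} \<times> {..<k-1}"
      using pq by (auto simp: noninc_perm_def dest!: in_set_takeD)
    then have "card {z \<in> set (take i pq). fst z = r} \<le> card ({r} \<times> {..<k-1})"
      by (intro card_mono) auto
    then show ?thesis by (simp add: card_cartesian_product)
  qed
  then show ?thesis by (auto simp: c grid_def)
qed

lemma Rounds_in_grid: "r \<in> Rounds n k F X \<Longrightarrow> r \<in> grid n k"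
  by (auto simp: Rounds_def is_arg_min_def intro: chain_in_grid)

lemma down_mats_mono: "S \<subseteq> T \<Longrightarrow> down_mats n k S \<subseteq> down_mats n k T"
  by (auto simp: down_mats_def)

text \<open>Rounding never increases the objective: \<open>f\<^sub>\<down>(X)\<close> averages \<open>F\<close> over the chain, and the rounding
  picks a smallest value on a chain. The permutations behind the two may be taken to coincide,
  since the value of \<open>f\<^sub>\<down>\<close> does not depend on its permutation.\<close>

lemma Rounds_le_f_down:
  assumes F: "normalized n F" and X: "X \<in> down_mats n k {0..1}" and r: "r \<in> Rounds n k F X"
  shows "ereal (F r) \<le> f_down n k F X"
proof -
  obtain pq i where pq: "noninc_perm n k X pq" and r_eq: "r = chain n pq i"
    and i: "is_arg_min (\<lambda>i. F (chain n pq i)) (\<lambda>i. i \<le> (k-1)*n) i"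
    using r by (auto simp: Rounds_def)
  note len = noninc_perm_length[OF pq]
  have unit: "0 \<le> X $$ (pq ! j) \<and> X $$ (pq ! j) \<le> 1" if "j < (k-1)*n" for j
  proof -
    have "pq ! j \<in> {..<n} \<times> {..<k-1}"
      using pq that len by (metis noninc_perm_def nth_mem)
    then show ?thesis using X by (cases "pq ! j") (auto simp: down_mats_def)
  qed
  have "F r - F (chain n pq 0) \<le> chain_sum n k F X pq"
    unfolding chain_sum_def
  proof (rule weighted_increments_lower_bound[where g = "\<lambda>j. F (chain n pq j)"])
    show "X $$ (pq ! j) \<le> X $$ (pq ! i)" if "i \<le> j" "j < (k-1)*n" for i j
      using noninc_perm_nth_mono[OF pq] that len by simp
  next
    show "F r \<le> F (chain n pq j)" if "j \<le> (k-1)*n" for j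
      using i that by (auto simp: r_eq is_arg_min_linorder)
  qed (rule unit)
  moreover have "F (chain n pq 0) = 0" using F by (simp add: normalized_def)
  moreover have "X \<in> down_mats n k UNIV" using X down_mats_mono[of "{0..1}" UNIV n k] by blast
  ultimately show ?thesis using f_down_eq[OF _ pq] by simp
qed

text \<open>The continuous extension restricts to \<open>F\<close> on binary matrices: the entries equal to \<open>1\<close> occupy
  an initial segment of the permutation, so the sum telescopes to the value of \<open>F\<close> at the end of
  that segment, where coordinate \<open>r\<close> counts the ones in row \<open>r\<close>.\<close>

lemma f_down_binary:
  assumes F: "normalized n F" and X: "X \<in> down_mats n k {0,1}"
  shows "f_down n k F X = ereal (F (Theta X))"
proof -
  obtain pq where pq: "noninc_perm n k X pq" using noninc_perm_exists by blast
  define N where "N = (k-1)*n"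
  have len: "length pq = N" using noninc_perm_length[OF pq] by (simp add: N_def)
  have S: "set pq = {..<n} \<times> {..<k-1}" using pq by (simp add: noninc_perm_def)
  have carrier: "dim_row X = n" "dim_col X = k-1" using X by (auto simp: down_mats_def)
  have binary: "X $$ z = 0 \<or> X $$ z = 1" if "z \<in> set pq" for z
    using X that S by (auto simp: down_mats_def)
  define s where "s = (LEAST i. i = N \<or> (i < N \<and> X $$ (pq ! i) = 0))"
  have s: "s = N \<or> (s < N \<and> X $$ (pq ! s) = 0)"
    unfolding s_def by (rule LeastI[of _ N]) simp
  then have "s \<le> N" by auto
  have val: "X $$ (pq ! i) = (if i < s then 1 else 0)" if i: "i < N" for i
  proof -
    have b: "X $$ (pq ! i) = 0 \<or> X $$ (pq ! i) = 1" using binary i len by simp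
    show ?thesis
    proof (cases "i < s")
      case True
      then have "\<not> (i = N \<or> (i < N \<and> X $$ (pq ! i) = 0))" unfolding s_def by (rule not_less_Least)
      then show ?thesis using b i True by auto
    next
      case False
      then have "X $$ (pq ! i) \<le> 0" using noninc_perm_nth_mono[OF pq, of s i] s i len by auto
      then show ?thesis using b False by auto
    qed
  qed
  have ones: "set (take s pq) = {z \<in> set pq. X $$ z = 1}"
  proof (intro equalityI subsetI)
    fix z assume "z \<in> set (take s pq)"
    then obtain i where "i < s" "z = pq ! i" using \<open>s \<le> N\<close> len by (auto simp: in_set_conv_nth)
    then show "z \<in> {z \<in> set pq. X $$ z = 1}" using val[of i] \<open>s \<le> N\<close> len by simp
  next
    fix z assume z: "z \<in> {z \<in> set pq. X $$ z = 1}"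
    then obtain i where i: "i < N" "z = pq ! i" using len by (auto simp: in_set_conv_nth)
    then have "i < s" using val[of i] z by (simp split: if_splits)
    then have "take s pq ! i = z" "i < length (take s pq)" using i len by simp_all
    then show "z \<in> set (take s pq)" by (metis nth_mem)
  qed
  have "chain n pq s = vec n (\<lambda>r. real (card {z \<in> set (take s pq). fst z = r}))"
    using pq len \<open>s \<le> N\<close> by (intro chain_eq_card[where B = "{..<k-1}"]) (auto simp: noninc_perm_def)
  also have "\<dots> = Theta X"
  proof (rule eq_vecI)
    fix r assume "r < dim_vec (Theta X)"
    then have r: "r < n" by (simp add: Theta_def carrier)
    have "{z \<in> set (take s pq). fst z = r} = Pair r ` {j \<in> {0..<k-1}. X $$ (r,j) = 1}"
      using r by (auto simp: ones S)
    then have "real (card {z \<in> set (take s pq). fst z = r}) = real (card {j \<in> {0..<k-1}. X $$ (r,j) = 1})"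
      by (simp add: card_image inj_on_def)
    also have "\<dots> = (\<Sum>j=0..<k-1. if X $$ (r,j) = 1 then 1 else 0)"
      by (simp add: sum.If_cases Int_def)
    also have "\<dots> = (\<Sum>j=0..<k-1. X $$ (r,j))"
      using r binary by (intro sum.cong) (auto simp: S)
    also have "\<dots> = Theta X $ r" using r by (simp add: Theta_def scalar_prod_def carrier)
    finally show "vec n (\<lambda>r. real (card {z \<in> set (take s pq). fst z = r})) $ r = Theta X $ r"
      using r by simp
  qed (simp add: Theta_def carrier)
  finally have reached: "chain n pq s = Theta X" .
  have "chain_sum n k F X pq = (\<Sum>i<N. if i < s then F (chain n pq (Suc i)) - F (chain n pq i) else 0)"
    unfolding chain_sum_def N_def[symmetric] by (rule sum.cong) (simp_all only: lessThan_iff val split: if_split, auto)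
  also have "\<dots> = (\<Sum>i<s. F (chain n pq (Suc i)) - F (chain n pq i))"
    using \<open>s \<le> N\<close> by (intro sum.mono_neutral_cong_right) auto
  also have "\<dots> = F (chain n pq s) - F (chain n pq 0)" by (rule sum_lessThan_telescope)
  finally have "chain_sum n k F X pq = F (Theta X)" using F by (simp add: reached normalized_def)
  moreover have "X \<in> down_mats n k UNIV" using X down_mats_mono[of "{0,1}" UNIV n k] by blast
  ultimately show ?thesis using f_down_eq[OF _ pq] by simp
qed

lemma f_down_Theta_inv:
  assumes "normalized n F" and "x \<in> grid n k"
  shows "f_down n k F (Theta_inv n k x) = ereal (F x)"
  using f_down_binary[OF assms(1) Theta_inv_mem] Theta_Theta_inv[OF assms(2)] by simp

theorem proposition4p4:
  fixes n k :: nat and F :: "real vec \<Rightarrow> real"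
  assumes "n \<ge> 1" and "k \<ge> 2"
    and "normalized n F"
  shows "(\<exists>X. is_arg_min (f_down n k F) (\<lambda>X. X \<in> down_mats n k {0..1}) X) \<and>
      ereal (MIN x\<in>grid n k. F x) = (INF X\<in>down_mats n k {0..1}. f_down n k F X) \<and>
      (\<forall>x. is_arg_min F (\<lambda>x. x \<in> grid n k) x \<longrightarrow>
         is_arg_min (f_down n k F) (\<lambda>X. X \<in> down_mats n k {0..1}) (Theta_inv n k x)) \<and>
      (\<forall>X. is_arg_min (f_down n k F) (\<lambda>X. X \<in> down_mats n k {0..1}) X \<longrightarrow>
         (\<forall>r\<in>Rounds n k F X. is_arg_min F (\<lambda>x. x \<in> grid n k) r))"
proof -
  let ?D = "down_mats n k {0..1}"
  note ext = f_down_Theta_inv[OF assms(3)]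
  note round_le = Rounds_le_f_down[OF assms(3)]
  have mem: "Theta_inv n k x \<in> ?D" for x
    using Theta_inv_mem[of n k x] down_mats_mono[of "{0,1}" "{0..1}" n k] by auto
  have inv_min: "is_arg_min (f_down n k F) (\<lambda>X. X \<in> ?D) (Theta_inv n k x)"
    if x: "is_arg_min F (\<lambda>x. x \<in> grid n k) x" for x
    unfolding is_arg_min_linorder
  proof (intro conjI allI impI mem)
    fix X assume X: "X \<in> ?D"
    obtain r where r: "r \<in> Rounds n k F X" using Rounds_nonempty by blast
    have "F x \<le> F r" using x Rounds_in_grid[OF r] by (simp add: is_arg_min_linorder)
    then have "ereal (F x) \<le> f_down n k F X" using round_le[OF X r] by (meson ereal_less_eq(3) order_trans)
    then show "f_down n k F (Theta_inv n k x) \<le> f_down n k F X"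
      using x by (simp add: ext is_arg_min_linorder)
  qed
  obtain x where x: "is_arg_min F (\<lambda>x. x \<in> grid n k) x"
    using ex_is_arg_min_if_finite[OF finite_grid grid_nonempty] by blast
  have "(MIN x\<in>grid n k. F x) = F x"
    using x by (intro Min_eqI) (auto simp: finite_grid is_arg_min_linorder)
  moreover have "(INF X\<in>?D. f_down n k F X) = f_down n k F (Theta_inv n k x)"
    using inv_min[OF x] by (intro antisym INF_lower INF_greatest) (auto simp: is_arg_min_linorder)
  ultimately have eq: "ereal (MIN x\<in>grid n k. F x) = (INF X\<in>?D. f_down n k F X)"
    using x by (simp add: ext is_arg_min_linorder)
  have round_min: "is_arg_min F (\<lambda>x. x \<in> grid n k) r"
    if X: "is_arg_min (f_down n k F) (\<lambda>X. X \<in> ?D) X" and r: "r \<in> Rounds n k F X" for X r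
    unfolding is_arg_min_linorder
  proof (intro conjI allI impI)
    show "r \<in> grid n k" using r by (rule Rounds_in_grid)
    fix y assume y: "y \<in> grid n k"
    have "ereal (F r) \<le> f_down n k F X" using X r by (intro round_le) (auto simp: is_arg_min_linorder)
    also have "\<dots> \<le> f_down n k F (Theta_inv n k y)" using X mem by (simp add: is_arg_min_linorder)
    also have "\<dots> = ereal (F y)" by (rule ext[OF y])
    finally show "F r \<le> F y" by simp
  qed
  show ?thesis using inv_min x eq round_min by blast
qed

end
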